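(* Let $\phi\in\Phi$ and $\nu>0$. Consider the problem $$(\mathrm{P})\qquad \min_{x\in\Omega,\,w\in\mathbb{R}^m}\Big\{\nu f(x)+\sum_{i=1}^m\phi(w_i):\ 0\le w\le e,\ \langle e-w,\mathcal{G}(x)\rangle=0\Big\}$$ and, for $\rho>0$, the problem $$(\mathrm{P}_\rho)\qquad \min_{x\in\Omega,\,w\in[0,e]}\Big\{\nu f(x)+\sum_{i=1}^m\phi(w_i)+\rho\langle e-w,\mathcal{G}(x)\rangle\Big\}.$$ Let $\mathcal{S}^*$ be the set of global optimal solutions of $(\mathrm{P})$ and $\mathcal{S}^*_\rho$ the set of global optimal solutions of $(\mathrm{P}_\rho)$. Then for every $\rho>\overline{\rho}:=\nu L_f\dfrac{(1-t_\phi^* )\,\phi_-'(1)}{1-\overline{t}_\phi}$ one has $\mathcal{S}^*_\rho=\mathcal{S}^*$.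
   Context: $\mathcal{J}_1,\dots,\mathcal{J}_m$ are nonempty, pairwise disjoint index sets with union $\{1,\dots,p\}$. For $x\in\mathbb{R}^p$, $x_{\mathcal{J}_i}$ is the subvector indexed by $\mathcal{J}_i$, $\|\cdot\|$ is the Euclidean norm, and $\mathcal{G}(x):=(\|x_{\mathcal{J}_1}\|,\dots,\|x_{\mathcal{J}_m}\|)^{\mathbb{T}}\in\mathbb{R}^m$. $e$ is the all-ones vector in $\mathbb{R}^m$, $[0,e]=\{w\in\mathbb{R}^m: 0\le w_i\le 1\ \forall i\}$. $\Omega:=\{x\in\mathbb{R}^p:\|x\|_\infty\le R\}$ for a given $R>0$. $f(x):=\frac{1}{2n}\|Ax-b\|^2$ with $A\in\mathbb{R}^{n\times p}$, $b\in\mathbb{R}^n$, and $L_f$ denotes the Lipschitz constant of $f$ on $\Omega$ (with respect to the Euclidean norm). $\Phi$ is the family of closed proper convex functions $\phi:\mathbb{R}\to(-\infty,+\infty]$ with $[0,1]\subseteq\mathrm{int}(\mathrm{dom}\,\phi)$, $\phi(1)=1$, and $\phi(t_\phi^* )=0$, where $t_\phi^*$ is the unique minimizer of $\phi$ over $[0,1]$. For $\phi\in\Phi$, $\overline{t}_\phi$ is the minimum element of $[t_\phi^*,1)$ such that $\frac{1}{1-t_\phi^*}\in\partial\phi(\overline{t}_\phi)$ (such an element exists), where $\partial\phi$ is the subdifferential; $\phi_-'$ is the left derivative. *)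

theory Defs
  imports "HOL-Analysis.Analysis"
begin

definition eff_dom :: "(real \<Rightarrow> ereal) \<Rightarrow> real set" where
  "eff_dom \<phi> = {t. \<phi> t < \<infinity>}"

definition epi :: "(real \<Rightarrow> ereal) \<Rightarrow> (real \<times> real) set" where
  "epi \<phi> = {(t, r). \<phi> t \<le> ereal r}"

text \<open>Convexity and closedness (lower semicontinuity) are those of the epigraph.\<close>

definition closed_proper_convex :: "(real \<Rightarrow> ereal) \<Rightarrow> bool" where
  "closed_proper_convex \<phi> \<longleftrightarrow>
     convex (epi \<phi>) \<and> closed (epi \<phi>) \<and> (\<forall>t. \<phi> t \<noteq> -\<infinity>) \<and> eff_dom \<phi> \<noteq> {}"

definition subdifferential :: "(real \<Rightarrow> ereal) \<Rightarrow> real \<Rightarrow> real set" where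
  "subdifferential \<phi> t = {g. \<forall>s. \<phi> s \<ge> \<phi> t + ereal (g * (s - t))}"

text \<open>Meaningful at interior points of the effective domain, where \<open>\<phi>\<close> is finite nearby.\<close>

definition left_deriv :: "(real \<Rightarrow> ereal) \<Rightarrow> real \<Rightarrow> real" where
  "left_deriv \<phi> t = vector_derivative (\<lambda>s. real_of_ereal (\<phi> s)) (at_left t)"

definition t_star :: "(real \<Rightarrow> ereal) \<Rightarrow> real" where
  "t_star \<phi> = (THE t. is_arg_min \<phi> (\<lambda>t. t \<in> {0..1}) t)"

definition Phi :: "(real \<Rightarrow> ereal) set" where
  "Phi = {\<phi>. closed_proper_convex \<phi> \<and> {0..1} \<subseteq> interior (eff_dom \<phi>) \<and> \<phi> 1 = 1 \<and>
             (\<exists>!t. is_arg_min \<phi> (\<lambda>t. t \<in> {0..1}) t) \<and> \<phi> (t_star \<phi>) = 0}"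

definition t_bar :: "(real \<Rightarrow> ereal) \<Rightarrow> real" where
  "t_bar \<phi> = (LEAST t. t \<in> {t_star \<phi>..<1} \<and> 1 / (1 - t_star \<phi>) \<in> subdifferential \<phi> t)"

definition group_norms :: "('m::finite \<Rightarrow> 'p::finite set) \<Rightarrow> real ^ 'p \<Rightarrow> real ^ 'm" where
  "group_norms J x = (\<chi> i. L2_set (\<lambda>j. x $ j) (J i))"

definition Omega :: "real \<Rightarrow> (real ^ 'p) set" where
  "Omega R = {x. infnorm x \<le> R}"

definition least_squares :: "real ^ 'p ^ 'n \<Rightarrow> real ^ 'n \<Rightarrow> real ^ 'p \<Rightarrow> real" where
  "least_squares A b x = 1 / (2 * real CARD('n)) * (norm (A *v x - b))\<^sup>2"

text \<open>The Lipschitz constant means the least one.\<close>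

definition Lipschitz_const :: "('a::metric_space \<Rightarrow> 'b::metric_space) \<Rightarrow> 'a set \<Rightarrow> real" where
  "Lipschitz_const f S = Inf {L. lipschitz_on L S f}"

text \<open>
  The vector \<open>1 :: real ^ 'm\<close> is the all-ones vector, and the order on
  \<open>real ^ 'm\<close> is componentwise, so \<open>{0..1}\<close> is the box \<open>[0, e]\<close>.
\<close>

definition P_feasible :: "('m::finite \<Rightarrow> 'p::finite set) \<Rightarrow> real \<Rightarrow> ((real ^ 'p) \<times> (real ^ 'm)) set" where
  "P_feasible J R = {(x, w). x \<in> Omega R \<and> w \<in> {0..1} \<and> (1 - w) \<bullet> group_norms J x = 0}"

definition P_objective ::
  "(real \<Rightarrow> ereal) \<Rightarrow> real \<Rightarrow> real ^ 'p ^ 'n \<Rightarrow> real ^ 'n \<Rightarrow> (real ^ 'p) \<times> (real ^ 'm) \<Rightarrow> ereal" where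
  "P_objective \<phi> \<nu> A b = (\<lambda>(x, w). ereal (\<nu> * least_squares A b x) + (\<Sum>i\<in>UNIV. \<phi> (w $ i)))"

definition P_solutions ::
  "(real \<Rightarrow> ereal) \<Rightarrow> real \<Rightarrow> real ^ 'p ^ 'n \<Rightarrow> real ^ 'n \<Rightarrow> ('m::finite \<Rightarrow> 'p::finite set) \<Rightarrow> real
     \<Rightarrow> ((real ^ 'p) \<times> (real ^ 'm)) set" where
  "P_solutions \<phi> \<nu> A b J R =
     {z. is_arg_min (P_objective \<phi> \<nu> A b) (\<lambda>z. z \<in> P_feasible J R) z}"

definition Prho_objective ::
  "(real \<Rightarrow> ereal) \<Rightarrow> real \<Rightarrow> real ^ 'p ^ 'n \<Rightarrow> real ^ 'n \<Rightarrow> ('m::finite \<Rightarrow> 'p::finite set) \<Rightarrow> real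
     \<Rightarrow> (real ^ 'p) \<times> (real ^ 'm) \<Rightarrow> ereal" where
  "Prho_objective \<phi> \<nu> A b J \<rho> =
     (\<lambda>(x, w). ereal (\<nu> * least_squares A b x) + (\<Sum>i\<in>UNIV. \<phi> (w $ i))
               + ereal (\<rho> * ((1 - w) \<bullet> group_norms J x)))"

definition Prho_solutions ::
  "(real \<Rightarrow> ereal) \<Rightarrow> real \<Rightarrow> real ^ 'p ^ 'n \<Rightarrow> real ^ 'n \<Rightarrow> ('m::finite \<Rightarrow> 'p::finite set) \<Rightarrow> real \<Rightarrow> real
     \<Rightarrow> ((real ^ 'p) \<times> (real ^ 'm)) set" where
  "Prho_solutions \<phi> \<nu> A b J R \<rho> =
     {z. is_arg_min (Prho_objective \<phi> \<nu> A b J \<rho>) (\<lambda>z. z \<in> Omega R \<times> {0..1}) z}"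

definition rho_bar ::
  "(real \<Rightarrow> ereal) \<Rightarrow> real \<Rightarrow> real ^ 'p ^ 'n \<Rightarrow> real ^ 'n \<Rightarrow> real \<Rightarrow> real" where
  "rho_bar \<phi> \<nu> A b R =
     \<nu> * Lipschitz_const (least_squares A b) (Omega R)
       * ((1 - t_star \<phi>) * left_deriv \<phi> 1 / (1 - t_bar \<phi>))"

end

theory Submission
  imports Defs
begin

text \<open>
  The penalty is exact because each infeasible point of the penalized problem is strictly beaten by
  a feasible point of the original one. If \<open>w $ i < 1\<close> on a nonzero group of norm \<open>u\<close>, then for
  \<open>\<rho> * u > left_deriv \<phi> 1\<close> raising \<open>w $ i\<close> to \<open>1\<close> lowers the cost, by convexity of \<open>\<phi>\<close>. For smaller
  \<open>u\<close> it is cheaper to delete the group and put \<open>w $ i = t_star \<phi>\<close>: the data-fitting term then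
  grows by at most \<open>\<nu> * u\<close> times the Lipschitz constant. Comparing minimal values this way needs no
  existence of minimizers.
\<close>

section \<open>Convex functions of one real variable\<close>

text \<open>Difference quotients based at \<open>x\<close> increase as \<open>s\<close> approaches
  \<open>x\<close> from the left and are bounded above, so their supremum is the left derivative.
  This determines the \<open>vector_derivative\<close>, and every quotient lies below it.\<close>

lemma convex_on_left_derivative_le:
  fixes g :: "real \<Rightarrow> real"
  assumes g: "convex_on S g" and "open S" and x: "x \<in> S" and y: "y \<in> S" "y < x"
  shows "g x - vector_derivative g (at_left x) * (x - y) \<le> g y"
proof -
  define q where "q s = (g s - g x) / (s - x)" for s
  have conv: "convex S"
    using g by (rule convex_on_imp_convex)
  \<comment> \<open>A point of \<open>S\<close> to the right of \<open>x\<close>: the slope from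
    \<open>x\<close> to it bounds all the quotients on the left.\<close>
  obtain e where e: "e > 0" "cball x e \<subseteq> S"
    using \<open>open S\<close> x open_contains_cball by blast
  then have xe: "x + e \<in> S"
    by (auto simp: subset_iff dist_real_def)
  have inS: "s \<in> S" if "y \<le> s" "s \<le> x" for s
    using mem_is_interval_1_I[OF conv[unfolded is_interval_convex_1[symmetric]] y(1) x that] .
  have mono: "q s \<le> q t" if "y \<le> s" "s \<le> t" "t < x" for s t
  proof (cases "s = t")
    case False
    then show ?thesis
      using convex_on_slope_le(2)[OF g inS x, of s t] that by (simp add: q_def)
  qed simp
  have bdd: "q s \<le> (g x - g (x + e)) / (x - (x + e))" if "y \<le> s" "s < x" for s
    using convex_on_slope_le[OF g inS xe, of s x] that e by (simp add: q_def)
  define M where "M = (SUP s\<in>{y..<x}. q s)"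
  have bdd': "bdd_above (q ` {y..<x})"
    using bdd by (auto intro!: bdd_aboveI2)
  have leM: "q s \<le> M" if "y \<le> s" "s < x" for s
    unfolding M_def using bdd' that by (intro cSUP_upper) auto
  have "(q \<longlongrightarrow> M) (at_left x)"
  proof (rule order_tendstoI)
    fix a assume "a < M"
    then obtain s where s: "s \<in> {y..<x}" "a < q s"
      unfolding M_def using less_cSUP_iff[OF _ bdd'] y by auto
    have "\<forall>\<^sub>F t in at_left x. t \<in> {s<..<x}"
      using s by (intro eventually_at_left_real) auto
    then show "\<forall>\<^sub>F t in at_left x. a < q t"
    proof eventually_elim
      case (elim t)
      then show ?case
        using mono[of s t] s by simp
    qed
  next
    fix a assume "M < a"
    have "\<forall>\<^sub>F t in at_left x. t \<in> {y<..<x}"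
      using y by (intro eventually_at_left_real)
    then show "\<forall>\<^sub>F t in at_left x. q t < a"
    proof eventually_elim
      case (elim t)
      then show ?case
        using leM[of t] \<open>M < a\<close> by simp
    qed
  qed
  then have "(g has_real_derivative M) (at_left x)"
    by (simp add: has_field_derivative_iff q_def[abs_def])
  then have "vector_derivative g (at_left x) = M"
    by (intro vector_derivative_within)
      (simp_all add: has_real_derivative_iff_has_vector_derivative)
  then show ?thesis
    using leM[of y] y by (simp add: q_def field_simps)
qed

text \<open>Convexity of the epigraph is applied at points of the graph. The resulting bound is
  finite, so convex combinations also stay in the effective domain.\<close>

lemma convex_on_eff_dom:
  assumes "closed_proper_convex \<phi>"
  shows "convex_on (eff_dom \<phi>) (\<lambda>t. real_of_ereal (\<phi> t))"
    and "\<And>t. t \<in> eff_dom \<phi> \<Longrightarrow> \<phi> t = ereal (real_of_ereal (\<phi> t))"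
proof -
  let ?g = "\<lambda>t. real_of_ereal (\<phi> t)"
  have epi: "convex (epi \<phi>)" and fin: "\<And>t. \<phi> t \<noteq> -\<infinity>"
    using assms by (auto simp: closed_proper_convex_def)
  show eq: "\<phi> t = ereal (?g t)" if "t \<in> eff_dom \<phi>" for t
    using that fin[of t] by (cases "\<phi> t") (auto simp: eff_dom_def)
  have *: "\<phi> (u * x + v * y) \<le> ereal (u * ?g x + v * ?g y)"
    if "x \<in> eff_dom \<phi>" "y \<in> eff_dom \<phi>" "0 \<le> u" "0 \<le> v" "u + v = 1" for x y u v
  proof -
    have "(x, ?g x) \<in> epi \<phi>" "(y, ?g y) \<in> epi \<phi>"
      using that eq[of x] eq[of y] by (auto simp: epi_def)
    from convexD[OF epi this that(3-5)] show ?thesis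
      by (simp add: epi_def)
  qed
  have dom: "u * x + v * y \<in> eff_dom \<phi>"
    if "x \<in> eff_dom \<phi>" "y \<in> eff_dom \<phi>" "0 \<le> u" "0 \<le> v" "u + v = 1" for x y u v
    using *[OF that] by (auto simp: eff_dom_def)
  show "convex_on (eff_dom \<phi>) ?g"
    unfolding convex_on_def
  proof (intro conjI ballI allI impI)
    show "convex (eff_dom \<phi>)"
      using dom by (auto simp: convex_def)
    fix x y u v :: real
    assume "x \<in> eff_dom \<phi>" "y \<in> eff_dom \<phi>" "0 \<le> u" "0 \<le> v" "u + v = 1"
    then show "?g (u *\<^sub>R x + v *\<^sub>R y) \<le> u * ?g x + v * ?g y"
      using *[of x y u v] eq[OF dom[of x y u v]] by (metis ereal_less_eq(3) real_scaleR_def)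
  qed
qed

section \<open>Real-valued form of a function in \<open>Phi\<close>, with its points
  \<open>t_star \<phi>\<close> and \<open>t_bar \<phi>\<close>\<close>

context
  fixes \<phi> :: "real \<Rightarrow> ereal" and g :: "real \<Rightarrow> real" and D :: "real set"
  assumes Phi: "\<phi> \<in> Phi"
  defines "g \<equiv> \<lambda>t. real_of_ereal (\<phi> t)" and "D \<equiv> interior (eff_dom \<phi>)"
begin

lemma Phi_dom: "open D" "{0..1} \<subseteq> D" "convex_on D g"
  and Phi_real: "t \<in> D \<Longrightarrow> \<phi> t = ereal (g t)"
proof -
  have "closed_proper_convex \<phi>"
    using Phi by (simp add: Phi_def)
  note c = convex_on_eff_dom[OF this]
  show "convex_on D g"
    unfolding g_def D_def using c(1) by (rule convex_on_subset)
      (simp_all add: interior_subset convex_on_imp_convex[OF c(1)])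
  show "t \<in> D \<Longrightarrow> \<phi> t = ereal (g t)"
    using c(2)[of t] interior_subset by (auto simp: D_def g_def)
  show "open D" "{0..1} \<subseteq> D"
    using Phi by (auto simp: D_def Phi_def)
qed

lemma Phi_one: "g 1 = 1"
  using Phi by (simp add: Phi_def g_def)

lemma t_star_is_arg_min: "is_arg_min \<phi> (\<lambda>t. t \<in> {0..1}) (t_star \<phi>)"
  unfolding t_star_def by (rule theI') (use Phi in \<open>simp add: Phi_def\<close>)

lemma t_star_props: "g (t_star \<phi>) = 0" "0 \<le> t_star \<phi>" "t_star \<phi> < 1"
  and Phi_nonneg: "t \<in> {0..1} \<Longrightarrow> 0 \<le> g t"
proof -
  have 0: "\<phi> (t_star \<phi>) = 0" "\<phi> 1 = 1"
    using Phi by (auto simp: Phi_def)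
  then show "g (t_star \<phi>) = 0"
    by (simp add: g_def)
  have "t_star \<phi> \<in> {0..1}"
    using t_star_is_arg_min by (simp add: is_arg_min_def)
  moreover have "t_star \<phi> \<noteq> 1"
    using 0 by force
  ultimately show "0 \<le> t_star \<phi>" "t_star \<phi> < 1"
    by auto
  assume t: "t \<in> {0..1}"
  then have "\<not> \<phi> t < \<phi> (t_star \<phi>)"
    using t_star_is_arg_min by (auto simp: is_arg_min_def)
  with t Phi_dom(2) Phi_real[of t] 0 show "0 \<le> g t"
    by auto
qed

text \<open>The tilted function is convex on the effective domain, so a minimum over the open set
  \<open>D\<close> is local and hence global there; elsewhere \<open>\<phi>\<close> is
  infinite.\<close>

lemma subdifferential_Phi_iff:
  assumes "t \<in> D"
  shows "c \<in> subdifferential \<phi> t \<longleftrightarrow> (\<forall>s\<in>D. g t - c * t \<le> g s - c * s)" (is "?L \<longleftrightarrow> ?R")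
proof
  assume L: ?L
  show ?R
  proof
    fix s assume "s \<in> D"
    with L have "ereal (g t) + ereal (c * (s - t)) \<le> ereal (g s)"
      using Phi_real[OF assms] Phi_real[of s] by (auto simp: subdifferential_def dest: spec[of _ s])
    then show "g t - c * t \<le> g s - c * s"
      by (simp add: algebra_simps)
  qed
next
  assume R: ?R
  have cpc: "closed_proper_convex \<phi>"
    using Phi by (simp add: Phi_def)
  note c = convex_on_eff_dom[OF cpc]
  let ?h = "\<lambda>s. g s - c * s"
  have h: "convex_on (eff_dom \<phi>) ?h"
  proof (rule convex_on_diff)
    show "convex_on (eff_dom \<phi>) g"
      using c(1) by (simp add: g_def)
    show "concave_on (eff_dom \<phi>) (\<lambda>s. c * s)"
      using c(1)[THEN convex_on_imp_convex]
      by (auto simp: concave_on_iff algebra_simps)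
  qed
  obtain e where e: "e > 0" "ball t e \<subseteq> D"
    using assms Phi_dom(1) open_contains_ball by blast
  have glob: "\<forall>s\<in>eff_dom \<phi>. ?h t \<le> ?h s"
  proof (rule convex_local_global_minimum[OF e(1) h])
    show "ball t e \<subseteq> eff_dom \<phi>"
      using e interior_subset by (auto simp: D_def)
    show "\<forall>y\<in>ball t e. ?h t \<le> ?h y"
      using R e by blast
  qed
  have "\<phi> t + ereal (c * (s - t)) \<le> \<phi> s" for s
  proof (cases "s \<in> eff_dom \<phi>")
    case True
    then have "\<phi> s = ereal (g s)"
      unfolding g_def by (rule c(2))
    with True show ?thesis
      using bspec[OF glob True] Phi_real[OF assms] by (simp add: algebra_simps)
  next
    case False
    then show ?thesis by (simp add: eff_dom_def)
  qed
  then show ?L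
    by (simp add: subdifferential_def)
qed

text \<open>
  With \<open>c = 1 / (1 - t_star \<phi>)\<close> the tilted function \<open>g t - c * t\<close> takes equal values at
  \<open>t_star \<phi>\<close> and \<open>1\<close>, so it has a minimizer over \<open>[t_star \<phi>, 1]\<close> in the open interval;
  convexity makes this minimizer global.
\<close>

lemma t_bar_props: "t_star \<phi> \<le> t_bar \<phi>" "t_bar \<phi> < 1"
proof -
  define a where "a = t_star \<phi>"
  define c where "c = 1 / (1 - a)"
  define h where "h t = g t - c * t" for t
  have a: "0 \<le> a" "a < 1" and ga: "g a = 0"
    using t_star_props by (auto simp: a_def)
  have D: "{a..1} \<subseteq> D"
    using Phi_dom(2) a by auto
  have eq: "h a = h 1"
    using a ga Phi_one by (simp add: h_def c_def field_simps)
  have cvx: "convex_on D h"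
    unfolding h_def
  proof (rule convex_on_diff)
    show "concave_on D (\<lambda>s. c * s)"
      using Phi_dom(3)[THEN convex_on_imp_convex] by (auto simp: concave_on_iff algebra_simps)
  qed (rule Phi_dom)
  have cont: "continuous_on {a..1} h"
    using convex_on_continuous[OF Phi_dom(1) cvx] D by (rule continuous_on_subset)
  obtain z where z: "z \<in> {a..1}" "\<And>y. y \<in> {a..1} \<Longrightarrow> h z \<le> h y"
    using continuous_attains_inf[OF compact_Icc _ cont] a by auto
  \<comment> \<open>If the minimizer \<open>z\<close> is an endpoint, its value is
    \<open>h a = h 1\<close>, and by convexity the midpoint is no worse.\<close>
  have "\<exists>y. a < y \<and> y < 1 \<and> h y \<le> h z"
  proof (cases "a < z \<and> z < 1")
    case False
    then have "z = a \<or> z = 1"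
      using z by auto
    then have hz: "h z = h a"
      using eq by auto
    have "h (midpoint a 1) \<le> h a"
      using convex_onD[OF cvx, of "1/2" a 1] D a eq
      by (simp add: midpoint_def subset_iff add_divide_distrib)
    then show ?thesis
      using a hz by (intro exI[of _ "midpoint a 1"]) (simp add: midpoint_def)
  qed auto
  then obtain y where y: "a < y" "y < 1" "h y \<le> h z"
    by auto
  have glob: "\<forall>s\<in>D. h y \<le> h s"
  proof (rule convex_local_global_minimum[OF _ cvx])
    show "0 < min (y - a) (1 - y)"
      using y by simp
    have sub: "ball y (min (y - a) (1 - y)) \<subseteq> {a..1}"
      by (auto simp: dist_real_def)
    then show "ball y (min (y - a) (1 - y)) \<subseteq> D"
      using D by blast
    show "\<forall>s\<in>ball y (min (y - a) (1 - y)). h y \<le> h s"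
      using sub z y(3) by (meson order_trans subsetD)
  qed
  \<comment> \<open>\<open>LEAST\<close> on the reals needs an attained minimum. Taking
    \<open>T\<close> inside the closed interval makes its infimum attained, and that infimum is at
    most \<open>y\<close>, hence below 1.\<close>
  define T where "T = {t \<in> {a..1}. h t = h y}"
  have "closed T"
    unfolding T_def using continuous_closed_preimage[OF cont closed_real_atLeastAtMost, of "{h y}"]
    by (simp add: vimage_def Int_def)
  moreover have "y \<in> T" "bdd_below T"
    using y by (auto simp: T_def)
  ultimately have inf: "Inf T \<in> T" "\<And>t. t \<in> T \<Longrightarrow> Inf T \<le> t"
    using closed_contains_Inf[of T] by (auto intro: cInf_lower)
  have iff: "t \<in> {a..<1} \<and> c \<in> subdifferential \<phi> t \<longleftrightarrow> t \<in> T \<and> t < 1" for t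
  proof -
    have "c \<in> subdifferential \<phi> t \<longleftrightarrow> h t = h y" if t: "t \<in> {a..1}"
    proof -
      have "t \<in> D" "y \<in> D"
        using t y D by auto
      then show ?thesis
        unfolding subdifferential_Phi_iff[OF \<open>t \<in> D\<close>] h_def[symmetric]
        using glob by (metis order_antisym)
    qed
    then show ?thesis
      by (auto simp: T_def)
  qed
  have "t_bar \<phi> = (LEAST t. t \<in> T \<and> t < 1)"
    by (simp only: t_bar_def iff flip: a_def c_def)
  also have "\<dots> = Inf T"
    using inf(1) inf(2)[OF \<open>y \<in> T\<close>] inf(2) y by (intro Least_equality) auto
  finally have tb: "t_bar \<phi> = Inf T" .
  show "t_bar \<phi> < 1"
    using inf(2)[OF \<open>y \<in> T\<close>] y tb by simp
  show "t_star \<phi> \<le> t_bar \<phi>"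
    using inf(1) tb by (simp add: T_def a_def)
qed

section \<open>Cost of a single group\<close>

lemma Phi_ge_left_tangent:
  assumes "0 \<le> w" "w \<le> 1"
  shows "1 - left_deriv \<phi> 1 * (1 - w) \<le> g w"
proof (cases "w = 1")
  case False
  then show ?thesis
    using convex_on_left_derivative_le[OF Phi_dom(3,1), of 1 w] Phi_dom(2) assms Phi_one
    unfolding left_deriv_def g_def by (simp add: subset_iff)
qed (use Phi_one in simp)

text \<open>The left tangent at 1 is evaluated at \<open>t_star \<phi>\<close>, where
  \<open>g\<close> vanishes. Since \<open>t_star \<phi> < 1\<close>, the left derivative is
  positive.\<close>

lemma left_deriv_ge: "1 \<le> (1 - t_star \<phi>) * left_deriv \<phi> 1"
  using Phi_ge_left_tangent[of "t_star \<phi>"] t_star_props by (simp add: algebra_simps)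

text \<open>
  The left-hand side is the cost of a group of norm \<open>u\<close> in the penalized problem. It exceeds the
  cost \<open>\<phi> 1 = 1\<close> of setting \<open>w = 1\<close> when \<open>\<rho> * u > left_deriv \<phi> 1\<close>; otherwise it exceeds the cost
  \<open>K * u\<close> of deleting the group, since it is affine in \<open>u\<close> and the comparison holds at both ends
  of \<open>[0, left_deriv \<phi> 1 / \<rho>]\<close>.
\<close>

lemma penalized_cost_gt:
  assumes K: "0 \<le> K" and \<rho>: "K * ((1 - t_star \<phi>) * left_deriv \<phi> 1 / (1 - t_bar \<phi>)) < \<rho>"
    and w: "0 \<le> w" "w < 1" and u: "0 < u"
  shows "left_deriv \<phi> 1 < \<rho> * u \<Longrightarrow> 1 < g w + \<rho> * ((1 - w) * u)"
    and "\<rho> * u \<le> left_deriv \<phi> 1 \<Longrightarrow> K * u < g w + \<rho> * ((1 - w) * u)"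
proof -
  define a where "a = left_deriv \<phi> 1"
  define s where "s = t_star \<phi>"
  define t where "t = t_bar \<phi>"
  have s: "0 \<le> s" "s < 1" and t: "s \<le> t" "t < 1" and a1: "1 \<le> (1 - s) * a"
    using t_star_props t_bar_props left_deriv_ge by (auto simp: a_def s_def t_def)
  have "0 < (1 - s) * a"
    using a1 by simp
  then have a0: "0 < a"
    using s by (simp add: zero_less_mult_iff)
  have \<rho>0: "0 < \<rho>"
  proof -
    have "0 \<le> K * ((1 - s) * a / (1 - t))"
      using K a0 s t by simp
    with \<rho> show ?thesis
      by (simp add: a_def s_def t_def)
  qed
  have \<rho>': "K * ((1 - s) * a) < \<rho> * (1 - t)"
    using \<rho> t by (simp add: field_simps a_def s_def t_def)
  have tan: "1 - a * (1 - w) \<le> g w"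
    using Phi_ge_left_tangent[of w] w by (simp add: a_def)
  show "1 < g w + \<rho> * ((1 - w) * u)" if "left_deriv \<phi> 1 < \<rho> * u"
  proof -
    have "a * (1 - w) < (\<rho> * u) * (1 - w)"
      using that w by (intro mult_strict_right_mono) (auto simp: a_def)
    with tan show ?thesis
      by (simp add: algebra_simps)
  qed
  show "K * u < g w + \<rho> * ((1 - w) * u)" if "\<rho> * u \<le> left_deriv \<phi> 1"
  proof -
    \<comment> \<open>The position of \<open>u\<close> in \<open>[0, a / \<rho>]\<close>, as a
      fraction of the length.\<close>
    define l where "l = \<rho> * u / a"
    have l: "0 < l" "l \<le> 1" and ul: "\<rho> * u = l * a"
      using that a0 u \<rho>0 by (auto simp: l_def a_def field_simps)
    \<comment> \<open>Replacing \<open>1 - t\<close> by the larger \<open>1 - s\<close> and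
      cancelling it leaves \<open>K * a < \<rho>\<close>, the comparison at the end
      \<open>l = 1\<close>.\<close>
    have "\<rho> * s \<le> \<rho> * t"
      using t \<rho>0 by simp
    with \<rho>' have "(K * a) * (1 - s) < \<rho> * (1 - s)"
      by (simp add: algebra_simps)
    then have "K * a < \<rho>"
      using s by simp
    then have "K * (\<rho> * u) < \<rho> * l"
      using l by (simp add: ul)
    then have "K * u < l"
      using \<rho>0 by (metis mult.left_commute mult_less_cancel_left_pos)
    \<comment> \<open>The tangent bound makes the bracket at least 1; afterwards
      \<open>l * g w \<le> g w\<close> because \<open>g w\<close> is nonnegative.\<close>
    also have "l \<le> l * (g w + a * (1 - w))"
      using tan l by simp
    also have "\<dots> \<le> g w + (\<rho> * u) * (1 - w)"
      unfolding ul using Phi_nonneg[of w] w l by (simp add: algebra_simps mult_left_le_one_le)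
    finally show ?thesis
      by (simp add: mult_ac)
  qed
qed

end

section \<open>The Lipschitz constant of the data-fitting term\<close>

text \<open>Residuals are bounded on the box, and a difference of squares factors. This makes the
  set of Lipschitz constants nonempty, so its infimum is meaningful.\<close>

lemma lipschitz_on_least_squares:
  fixes A :: "real ^ 'p ^ 'n"
  shows "\<exists>L. lipschitz_on L (Omega R) (least_squares A b)"
proof -
  obtain B where B: "0 < B" "\<And>x. norm (A *v x) \<le> B * norm x"
    using bounded_linear.pos_bounded[OF matrix_vector_mul_bounded_linear[of A]]
    by (auto simp: mult.commute)
  define S where "S = sqrt DIM(real ^ 'p) * \<bar>R\<bar>"
  define M where "M = B * S + norm b"
  define k where "k = 1 / (2 * real CARD('n))"
  have M0: "0 \<le> M"
    using B by (simp add: M_def S_def)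
  have M: "norm (A *v x - b) \<le> M" if "x \<in> Omega R" for x
  proof -
    have "norm x \<le> sqrt DIM(real ^ 'p) * infnorm x"
      by (rule norm_le_infnorm)
    also have "\<dots> \<le> S"
      using that unfolding S_def by (intro mult_left_mono) (auto simp: Omega_def)
    finally have "B * norm x \<le> B * S"
      using B by simp
    then show ?thesis
      using B(2)[of x] norm_triangle_ineq4[of "A *v x" b] unfolding M_def by linarith
  qed
  have "lipschitz_on (k * (2 * M * B)) (Omega R) (least_squares A b)"
  proof (rule lipschitz_onI)
    show "0 \<le> k * (2 * M * B)"
      using M0 B by (simp add: k_def)
    fix x y :: "real ^ 'p" assume xy: "x \<in> Omega R" "y \<in> Omega R"
    let ?p = "norm (A *v x - b)" and ?q = "norm (A *v y - b)"
    have "\<bar>?p\<^sup>2 - ?q\<^sup>2\<bar> = (?p + ?q) * \<bar>?p - ?q\<bar>"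
      by (simp add: power2_eq_square square_diff_square_factored abs_mult)
    also have "\<dots> \<le> (2 * M) * (B * norm (x - y))"
    proof (rule mult_mono)
      have "\<bar>?p - ?q\<bar> \<le> norm ((A *v x - b) - (A *v y - b))"
        by (rule norm_triangle_ineq3)
      also have "\<dots> = norm (A *v (x - y))"
        by (simp add: matrix_vector_mult_diff_distrib)
      also have "\<dots> \<le> B * norm (x - y)"
        by (rule B)
      finally show "\<bar>?p - ?q\<bar> \<le> B * norm (x - y)" .
    qed (use M[OF xy(1)] M[OF xy(2)] M0 in auto)
    finally have "k * \<bar>?p\<^sup>2 - ?q\<^sup>2\<bar> \<le> k * ((2 * M) * (B * norm (x - y)))"
      by (intro mult_left_mono) (auto simp: k_def)
    moreover have "dist (least_squares A b x) (least_squares A b y) = k * \<bar>?p\<^sup>2 - ?q\<^sup>2\<bar>"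
      by (simp add: least_squares_def dist_real_def k_def flip: diff_divide_distrib)
    ultimately show "dist (least_squares A b x) (least_squares A b y) \<le> k * (2 * M * B) * dist x y"
      by (simp add: dist_norm algebra_simps)
  qed
  then show ?thesis ..
qed

text \<open>The infimum is attained: each quotient of distances is a lower bound for all Lipschitz
  constants.\<close>

lemma lipschitz_on_Lipschitz_const:
  assumes "lipschitz_on L S f"
  shows "lipschitz_on (Lipschitz_const f S) S f"
proof (rule lipschitz_onI)
  let ?X = "{L. lipschitz_on L S f}"
  have ne: "?X \<noteq> {}"
    using assms by auto
  show "0 \<le> Lipschitz_const f S"
    unfolding Lipschitz_const_def using ne by (rule cInf_greatest) (auto dest: lipschitz_on_nonneg)
  fix x y assume xy: "x \<in> S" "y \<in> S"
  show "dist (f x) (f y) \<le> Lipschitz_const f S * dist x y"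
  proof (cases "x = y")
    case False
    have "dist (f x) (f y) / dist x y \<le> Lipschitz_const f S"
      unfolding Lipschitz_const_def
    proof (rule cInf_greatest[OF ne])
      fix K assume "K \<in> ?X"
      then show "dist (f x) (f y) / dist x y \<le> K"
        using lipschitz_onD[of K S f x y] xy False by (simp add: divide_simps)
    qed
    then show ?thesis
      using False by (simp add: divide_simps)
  qed simp
qed

section \<open>Deleting groups of coordinates\<close>

definition drop_groups :: "('m \<Rightarrow> 'p::finite set) \<Rightarrow> 'm set \<Rightarrow> real ^ 'p \<Rightarrow> real ^ 'p" where
  "drop_groups J Z x = (\<chi> j. if j \<in> (\<Union>i\<in>Z. J i) then 0 else x $ j)"

lemma drop_groups_in_Omega:
  assumes "x \<in> Omega R"
  shows "drop_groups J Z x \<in> Omega R"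
proof -
  have "infnorm (drop_groups J Z x) \<le> infnorm x"
    unfolding infnorm_cart[of "drop_groups J Z x"]
  proof (rule cSup_least)
    fix r assume "r \<in> {\<bar>drop_groups J Z x $ j\<bar> |j. j \<in> UNIV}"
    then show "r \<le> infnorm x"
      using component_le_infnorm_cart[of x] infnorm_pos_le[of x] by (auto simp: drop_groups_def)
  qed auto
  with assms show ?thesis
    by (simp add: Omega_def)
qed

lemma group_norms_nonneg: "0 \<le> group_norms J x $ i"
  by (simp add: group_norms_def)

text \<open>Disjointness ensures that deleting one group leaves the others intact.\<close>

lemma group_norms_drop_groups:
  assumes "disjoint_family J"
  shows "group_norms J (drop_groups J Z x) $ i = (if i \<in> Z then 0 else group_norms J x $ i)"
proof -
  have "j \<in> (\<Union>i\<in>Z. J i) \<longleftrightarrow> i \<in> Z" if "j \<in> J i" for j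
  proof -
    have "j \<in> J k \<longleftrightarrow> k = i" for k
      using disjoint_family_onD[OF assms, of k i] that by auto
    then show ?thesis
      by simp
  qed
  then have "drop_groups J Z x $ j = (if i \<in> Z then 0 else x $ j)" if "j \<in> J i" for j
    using that by (simp only: drop_groups_def vec_lambda_beta)
  then have "L2_set (\<lambda>j. drop_groups J Z x $ j) (J i) = L2_set (\<lambda>j. if i \<in> Z then 0 else x $ j) (J i)"
    by (intro L2_set_cong) auto
  then show ?thesis
    by (simp add: group_norms_def L2_set_def)
qed

text \<open>The deleted part is a sum of blocks, one per group, so the triangle inequality applies.
  The bound is additive over groups, as is the rest of the cost.\<close>

lemma norm_diff_drop_groups_le:
  fixes J :: "'m::finite \<Rightarrow> 'p::finite set"
  assumes "disjoint_family J"
  shows "norm (x - drop_groups J Z x) \<le> (\<Sum>i\<in>Z. group_norms J x $ i)"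
proof -
  define P where "P i = (\<chi> j. if j \<in> J i then x $ j else 0)" for i
  have "x - drop_groups J Z x = (\<Sum>i\<in>Z. P i)"
  proof (rule vec_eq_iff[THEN iffD2], rule allI)
    fix j
    show "(x - drop_groups J Z x) $ j = (\<Sum>i\<in>Z. P i) $ j"
    proof (cases "\<exists>i\<in>Z. j \<in> J i")
      case True
      then obtain i where i: "i \<in> Z" "j \<in> J i"
        by auto
      have "j \<in> J k \<longleftrightarrow> k = i" for k
        using i assms by (auto simp: disjoint_family_on_def)
      then show ?thesis
        using i by (auto simp: drop_groups_def P_def)
    qed (auto simp: drop_groups_def P_def)
  qed
  also have "norm \<dots> \<le> (\<Sum>i\<in>Z. norm (P i))"
    by (rule norm_sum)
  also have "\<dots> = (\<Sum>i\<in>Z. group_norms J x $ i)"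
    by (simp add: norm_vec_def P_def group_norms_def L2_set_def if_distrib[of abs]
        if_distrib[of "\<lambda>y. y ^ 2"] sum.If_cases cong: if_cong)
  finally show ?thesis .
qed

section \<open>Exactness of the penalty\<close>

text \<open>
  Every complementarity-violating coordinate \<open>i\<close> is repaired, by \<open>w $ i = 1\<close> if its group is heavy
  and by deleting the group and \<open>w $ i = t_star \<phi>\<close> if it is light.
\<close>

lemma exact_penalty:
  fixes J :: "'m::finite \<Rightarrow> 'p::finite set" and A :: "real ^ 'p ^ 'n"
  assumes J: "disjoint_family J" and Phi: "\<phi> \<in> Phi" and \<nu>: "0 < \<nu>"
    and \<rho>: "rho_bar \<phi> \<nu> A b R < \<rho>"
    and z: "z \<in> Omega R \<times> {0..1}" "z \<notin> P_feasible J R"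
  shows "\<exists>z'\<in>P_feasible J R. P_objective \<phi> \<nu> A b z' < Prho_objective \<phi> \<nu> A b J \<rho> z"
proof -
  obtain x w where zxw: "z = (x, w)"
    by (cases z)
  define g where "g t = real_of_ereal (\<phi> t)" for t
  define L where "L = Lipschitz_const (least_squares A b) (Omega R)"
  define a where "a = left_deriv \<phi> 1"
  define u where "u i = group_norms J x $ i" for i
  define bad where "bad i \<longleftrightarrow> w $ i < 1 \<and> 0 < u i" for i
  define Z where "Z = {i. bad i \<and> \<rho> * u i \<le> a}"
  define x' where "x' = drop_groups J Z x"
  \<comment> \<open>On a deleted group complementarity holds for any weight, and
    \<open>t_star \<phi>\<close> has cost 0.\<close>
  define w' where "w' = (\<chi> i. if bad i then if i \<in> Z then t_star \<phi> else 1 else w $ i)"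
  have x: "x \<in> Omega R" and w: "\<And>i. 0 \<le> w $ i" "\<And>i. w $ i \<le> 1"
    using z by (auto simp: zxw less_eq_vec_def)
  have u0: "0 \<le> u i" for i
    by (simp add: u_def group_norms_nonneg)
  have lip: "lipschitz_on L (Omega R) (least_squares A b)"
    unfolding L_def using lipschitz_on_least_squares[of R A b] lipschitz_on_Lipschitz_const by blast
  have K: "0 \<le> \<nu> * L"
    using lipschitz_on_nonneg[OF lip] \<nu> by simp
  note cost = penalized_cost_gt[OF Phi K \<rho>[unfolded rho_bar_def, folded L_def], folded g_def a_def]
  note ts = t_star_props[OF Phi, folded g_def]
  have dom: "\<phi> t = ereal (g t)" if "0 \<le> t" "t \<le> 1" for t
    using Phi_real[OF Phi, of t] Phi_dom(2)[OF Phi] that by (auto simp: g_def)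
  have x': "x' \<in> Omega R"
    unfolding x'_def using x by (rule drop_groups_in_Omega)
  have w': "0 \<le> w' $ i" "w' $ i \<le> 1" for i
    using w ts by (auto simp: w'_def)
  have u': "group_norms J x' $ i = (if i \<in> Z then 0 else u i)" for i
    unfolding x'_def u_def by (rule group_norms_drop_groups[OF J])
  have good: "(1 - w $ i) * u i = 0" if "\<not> bad i" for i
    using that w(2)[of i] u0[of i] by (auto simp: bad_def)
  have feas: "(x', w') \<in> P_feasible J R"
  proof -
    have "(1 - w' $ i) * group_norms J x' $ i = 0" for i
      using good[of i] by (auto simp: u' w'_def Z_def)
    then have "(1 - w') \<bullet> group_norms J x' = 0"
      unfolding inner_vec_def by (intro sum.neutral) simp
    then show ?thesis
      using x' w' by (simp add: P_feasible_def less_eq_vec_def)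
  qed
  \<comment> \<open>Costs per group before and after the repair; \<open>c'\<close> charges each
    deleted group its share of the Lipschitz bound on the growth of the data-fitting term.\<close>
  define c where "c i = g (w $ i) + \<rho> * ((1 - w $ i) * u i)" for i
  define c' where "c' i = g (w' $ i) + (if i \<in> Z then \<nu> * L * u i else 0)" for i
  have lt: "c' i < c i" if "bad i" for i
    using cost[OF w(1), of i "u i"] that ts Phi_one[OF Phi, folded g_def]
    by (auto simp: bad_def c_def c'_def w'_def Z_def)
  have le: "c' i \<le> c i" for i
  proof (cases "bad i")
    case False
    then show ?thesis
      using good[of i] by (auto simp: c_def c'_def w'_def Z_def)
  qed (use lt in \<open>simp add: less_imp_le\<close>)
  \<comment> \<open>Infeasibility of \<open>z\<close> supplies one strict inequality among the
    groups.\<close>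
  have "\<exists>i. bad i"
  proof (rule ccontr)
    assume "\<nexists>i. bad i"
    then have "(1 - w) \<bullet> group_norms J x = 0"
      unfolding inner_vec_def using good by (intro sum.neutral) (simp add: u_def)
    then show False
      using z by (auto simp: zxw P_feasible_def)
  qed
  then have sum_lt: "(\<Sum>i\<in>UNIV. c' i) < (\<Sum>i\<in>UNIV. c i)"
    using le lt by (intro sum_strict_mono_ex1) auto
  have "least_squares A b x' - least_squares A b x \<le> L * norm (x - x')"
    using lipschitz_onD[OF lip x x'] by (simp add: dist_norm)
  also have "\<dots> \<le> L * (\<Sum>i\<in>Z. u i)"
    unfolding x'_def u_def using norm_diff_drop_groups_le[OF J]
    by (intro mult_left_mono lipschitz_on_nonneg[OF lip])
  finally have "\<nu> * (least_squares A b x' - least_squares A b x) \<le> \<nu> * (L * (\<Sum>i\<in>Z. u i))"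
    using \<nu> by simp
  also have "\<dots> = (\<Sum>i\<in>UNIV. if i \<in> Z then \<nu> * L * u i else 0)"
    by (simp add: sum.If_cases sum_distrib_left mult.assoc)
  finally have "\<nu> * least_squares A b x' + (\<Sum>i\<in>UNIV. g (w' $ i))
      \<le> \<nu> * least_squares A b x + (\<Sum>i\<in>UNIV. c' i)"
    by (simp add: c'_def sum.distrib algebra_simps)
  also have "\<dots> < \<nu> * least_squares A b x + (\<Sum>i\<in>UNIV. c i)"
    using sum_lt by simp
  also have "\<dots> = \<nu> * least_squares A b x + (\<Sum>i\<in>UNIV. g (w $ i))
      + \<rho> * ((1 - w) \<bullet> group_norms J x)"
    by (simp add: c_def sum.distrib inner_vec_def u_def sum_distrib_left)
  finally have "P_objective \<phi> \<nu> A b (x', w') < Prho_objective \<phi> \<nu> A b J \<rho> z"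
    using dom w w' by (simp add: P_objective_def Prho_objective_def zxw)
  with feas show ?thesis
    by blast
qed

lemma Prho_objective_eq_P_objective:
  "z \<in> P_feasible J R \<Longrightarrow> Prho_objective \<phi> \<nu> A b J \<rho> z = P_objective \<phi> \<nu> A b z"
  by (auto simp: P_feasible_def Prho_objective_def P_objective_def)

theorem theorem2p1:
  fixes J :: "'m::finite \<Rightarrow> 'p::finite set"
    and A :: "real ^ 'p ^ 'n" and b :: "real ^ 'n::finite"
    and \<phi> :: "real \<Rightarrow> ereal" and R \<nu> \<rho> :: real
  assumes "\<And>i. J i \<noteq> {}" and "disjoint_family J" and "(\<Union>i. J i) = UNIV"
    and "R > 0" and "\<phi> \<in> Phi" and "\<nu> > 0"
    and "\<rho> > rho_bar \<phi> \<nu> A b R"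
  shows "Prho_solutions \<phi> \<nu> A b J R \<rho> = P_solutions \<phi> \<nu> A b J R"
proof -
  let ?F = "P_feasible J R" and ?B = "Omega R \<times> {0..1}"
  let ?p = "P_objective \<phi> \<nu> A b" and ?q = "Prho_objective \<phi> \<nu> A b J \<rho>"
  have sub: "z \<in> ?B" if "z \<in> ?F" for z
    using that by (auto simp: P_feasible_def)
  have eq: "?q z = ?p z" if "z \<in> ?F" for z
    using that by (rule Prho_objective_eq_P_objective)
  have pen: "\<exists>z'\<in>?F. ?p z' < ?q z" if "z \<in> ?B" "z \<notin> ?F" for z
    using assms(2,5-7) that by (intro exact_penalty)
  have "is_arg_min ?q (\<lambda>z. z \<in> ?B) z \<longleftrightarrow> is_arg_min ?p (\<lambda>z. z \<in> ?F) z" for z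
  proof
    assume "is_arg_min ?q (\<lambda>z. z \<in> ?B) z"
    then have zB: "z \<in> ?B" and min: "\<And>y. y \<in> ?B \<Longrightarrow> ?q z \<le> ?q y"
      by (auto simp: is_arg_min_def not_less)
    have "?q z \<le> ?p y" if "y \<in> ?F" for y
      using min[OF sub[OF that]] eq[OF that] by simp
    \<comment> \<open>Otherwise \<open>pen\<close> would give a feasible point strictly below the
      penalized minimum.\<close>
    moreover from this have zF: "z \<in> ?F"
      using pen[OF zB] leD by blast
    ultimately show "is_arg_min ?p (\<lambda>z. z \<in> ?F) z"
      using eq[OF zF] by (simp add: is_arg_min_def not_less)
  next
    assume "is_arg_min ?p (\<lambda>z. z \<in> ?F) z"
    then have zF: "z \<in> ?F" and min: "\<And>y. y \<in> ?F \<Longrightarrow> ?p z \<le> ?p y"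
      by (auto simp: is_arg_min_def not_less)
    \<comment> \<open>An infeasible \<open>y\<close> lies strictly above some feasible point, whose
      value is at least that of \<open>z\<close>.\<close>
    have "?p z \<le> ?q y" if y: "y \<in> ?B" for y
    proof (cases "y \<in> ?F")
      case True
      then show ?thesis
        using min eq by simp
    next
      case False
      then obtain y' where "y' \<in> ?F" "?p y' < ?q y"
        using pen[OF y] by blast
      then show ?thesis
        using min[of y'] by simp
    qed
    then show "is_arg_min ?q (\<lambda>z. z \<in> ?B) z"
      using sub[OF zF] eq[OF zF] by (simp only: is_arg_min_def) (simp add: not_less del: mem_Sigma_iff)
  qed
  then show ?thesis
    by (simp add: Prho_solutions_def P_solutions_def)
qed

end
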